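(* Let $X$ be a Banach space, $A$ the infinitesimal generator of a $C_0$-semigroup $(S_t)_{t\ge 0}$ on $X$ with $\|S_t\|\le M e^{\beta t}$ for all $t\ge 0$, where $M\ge 1$ and $\beta\in\mathbb{R}$. Let $\alpha:X\to X$ be Lipschitz continuous with Lipschitz constant $L\ge 0$, and let $K\subset X$ be a nonempty closed subset. For each $\epsilon\ge 0$ the implications (i) $\Rightarrow$ (ii) $\Rightarrow$ (iii) $\Rightarrow$ (iv) hold, where: (i) $\liminf_{t\downarrow 0}\frac1t d_K(S_t x+t\alpha(x))\le \epsilon$ for all $x\in K$. (ii) $d_K(\xi(t;x))\le M\big(e^{(\beta+ML)t}d_K(x)+\varphi_{\beta+ML}(t)\,\epsilon\big)$ for all $(t,x)\in\mathbb{R}_+\times X$. (iii) There is $\delta>0$ such that $d_K(\xi(t;x))\le M\varphi_{\beta+ML}(t)\,\epsilon$ for all $(t,x)\in[0,\delta]\times K$. (iv) $\liminf_{t\downarrow 0}\frac1t d_K(S_t x+t\alpha(x))\le M\epsilon$ for all $x\in K$.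
   Context: $\mathbb{R}_+=[0,\infty)$. $d_K(x):=\inf_{y\in K}\|x-y\|$ is the distance function of $K$. For $x\in X$, $\xi(\cdot;x):\mathbb{R}_+\to X$ is the unique mild solution of $\dot\xi(t)=A\xi(t)+\alpha(\xi(t))$, $\xi(0)=x$, i.e. the unique continuous function with $\xi(t;x)=S_t x+\int_0^t S_{t-s}\alpha(\xi(s;x))\,ds$ for all $t\in\mathbb{R}_+$. For $\gamma\in\mathbb{R}$, $\varphi_\gamma(t):=\int_0^t e^{\gamma(t-s)}\,ds$, $t\in\mathbb{R}_+$. Lipschitz constant $L$ means $\|\alpha(x)-\alpha(y)\|\le L\|x-y\|$ for all $x,y\in X$. *)

theory Defs
  imports "HOL-Analysis.Analysis"
begin

text \<open>
  Only times \<open>t \<ge> 0\<close> are meaningful: the values \<open>S t\<close> and \<open>u t\<close> for \<open>t < 0\<close> are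
  left unconstrained throughout.
\<close>

definition C0_semigroup :: "(real \<Rightarrow> 'a::banach \<Rightarrow>\<^sub>L 'a) \<Rightarrow> bool" where
  "C0_semigroup S \<longleftrightarrow>
     S 0 = id_blinfun \<and>
     (\<forall>s\<ge>0. \<forall>t\<ge>0. S (s + t) = S s o\<^sub>L S t) \<and>
     (\<forall>x. ((\<lambda>t. blinfun_apply (S t) x) \<longlongrightarrow> x) (at_right 0))"

text \<open>
  The (in general unbounded) operator with domain \<open>D\<close> is represented by \<open>D\<close> together with a total
  function \<open>A\<close> whose values outside \<open>D\<close> are irrelevant.
\<close>

definition infinitesimal_generator ::
  "'a set \<Rightarrow> ('a \<Rightarrow> 'a) \<Rightarrow> (real \<Rightarrow> 'a::banach \<Rightarrow>\<^sub>L 'a) \<Rightarrow> bool" where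
  "infinitesimal_generator D A S \<longleftrightarrow>
     D = {x. \<exists>y. ((\<lambda>t. (blinfun_apply (S t) x - x) /\<^sub>R t) \<longlongrightarrow> y) (at_right 0)} \<and>
     (\<forall>x\<in>D. ((\<lambda>t. (blinfun_apply (S t) x - x) /\<^sub>R t) \<longlongrightarrow> A x) (at_right 0))"

text \<open>
  Mild solutions of \<open>u' = A u + \<alpha> u\<close>, \<open>u 0 = x\<close>, where \<open>A\<close> generates \<open>S\<close>. For continuous \<open>\<alpha>\<close> the
  integrand is continuous on \<open>{0..t}\<close>, so the integral never takes its default value.
\<close>

definition mild_solution ::
  "(real \<Rightarrow> 'a::banach \<Rightarrow>\<^sub>L 'a) \<Rightarrow> ('a \<Rightarrow> 'a) \<Rightarrow> 'a \<Rightarrow> (real \<Rightarrow> 'a) \<Rightarrow> bool" where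
  "mild_solution S \<alpha> x u \<longleftrightarrow>
     continuous_on {0..} u \<and>
     (\<forall>t\<ge>0. u t = blinfun_apply (S t) x
              + integral {0..t} (\<lambda>s. blinfun_apply (S (t - s)) (\<alpha> (u s))))"

definition phi :: "real \<Rightarrow> real \<Rightarrow> real" where
  "phi \<gamma> t = integral {0..t} (\<lambda>s. exp (\<gamma> * (t - s)))"

end

theory Submission
  imports Defs
begin

text \<open>
  The delicate step is from the tangency condition on \<open>K\<close> to the estimate for the flow. Gronwall's
  inequality makes \<open>\<xi>\<close> a semiflow with \<open>dist (\<xi> t x) (\<xi> t y) \<le> M e\<^sup>\<omega>\<^sup>t dist x y\<close>, \<open>\<omega> = \<beta> + M L\<close>,
  and the equivalent metric \<open>\<rho> x y = sup\<^sub>t e\<^sup>-\<^sup>\<omega>\<^sup>t dist (\<xi> t x) (\<xi> t y)\<close> removes the factor \<open>M\<close>. Since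
  nearest points of \<open>K\<close> need not exist, no differential inequality for the distance to \<open>K\<close> is
  available; instead a Brezis--Browder argument on pairs of a time and a point of \<open>K\<close> produces, for
  each start in \<open>K\<close> and each time \<open>t\<close>, a point of \<open>K\<close> whose \<open>\<rho>\<close>-distance to the trajectory is
  at most \<open>M c \<phi>\<^sub>\<omega>(t)\<close>, for every \<open>c > \<epsilon>\<close>. The recovery of the tangency condition rests on
  \<open>\<xi> t x = S t x + t \<alpha> x + o(t)\<close>.
\<close>

section \<open>The weight \<open>phi\<close>: closed form, cocycle identity, behaviour at
  zero\<close>

lemma phi_eq:
  assumes "t \<ge> 0"
  shows "phi \<gamma> t = (if \<gamma> = 0 then t else (exp (\<gamma> * t) - 1) / \<gamma>)"
proof (cases "\<gamma> = 0")
  case True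
  then show ?thesis using assms by (simp add: phi_def)
next
  case False
  have "((\<lambda>s. exp (\<gamma> * (t - s))) has_integral
      (- exp (\<gamma> * (t - t)) / \<gamma>) - (- exp (\<gamma> * (t - 0)) / \<gamma>)) {0..t}"
    using False
    by (intro fundamental_theorem_of_calculus assms)
      (auto intro!: derivative_eq_intros simp flip: has_real_derivative_iff_has_vector_derivative)
  then show ?thesis
    using False unfolding phi_def by (simp add: integral_unique diff_divide_distrib)
qed

lemma phi_0 [simp]: "phi \<gamma> 0 = 0"
  by (simp add: phi_eq)

text \<open>The law by which errors accumulate: what arose during the first \<open>s\<close> is
  amplified by \<open>exp (\<gamma> * t)\<close>, and the error of the following \<open>t\<close> is
  added. It is what makes \<open>precedes\<close> transitive.\<close>

lemma phi_add:
  assumes "s \<ge> 0" "t \<ge> 0"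
  shows "phi \<gamma> (s + t) = exp (\<gamma> * t) * phi \<gamma> s + phi \<gamma> t"
  using assms by (auto simp: phi_eq field_simps exp_add)

lemma continuous_on_phi: "continuous_on {0..} (phi \<gamma>)"
proof -
  have "continuous_on {0..} (\<lambda>t. if \<gamma> = 0 then t else (exp (\<gamma> * t) - 1) / \<gamma>)"
    by (cases "\<gamma> = 0") (auto intro!: continuous_intros)
  then show ?thesis
    by (rule continuous_on_eq) (auto simp: phi_eq)
qed

text \<open>The quotient is a difference quotient of the closed form at 0. It exchanges bounds
  linear in \<open>h\<close> for bounds in \<open>phi \<gamma> h\<close> at small times, which both
  directions of the main argument need.\<close>

lemma phi_over_tendsto_1: "((\<lambda>t. phi \<gamma> t / t) \<longlongrightarrow> 1) (at_right 0)"
proof -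
  have "((\<lambda>t. if \<gamma> = 0 then t else (exp (\<gamma> * t) - 1) / \<gamma>) has_real_derivative 1) (at 0)"
    by (cases "\<gamma> = 0") (auto intro!: derivative_eq_intros)
  then have "((\<lambda>t. (if \<gamma> = 0 then t else (exp (\<gamma> * t) - 1) / \<gamma>) / t) \<longlongrightarrow> 1) (at 0)"
    by (simp add: has_field_derivative_iff cong: if_cong)
  then have "((\<lambda>t. (if \<gamma> = 0 then t else (exp (\<gamma> * t) - 1) / \<gamma>) / t) \<longlongrightarrow> 1) (at_right 0)"
    by (rule tendsto_mono[rotated]) (simp add: at_le)
  then show ?thesis
    by (rule Lim_transform_eventually)
      (auto simp: phi_eq eventually_at_right_field intro!: exI[of _ 1])
qed

section \<open>Exponentially Lipschitz semiflows\<close>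

text \<open>Only the metric and the semiflow law enter the invariance argument, so it is carried out
  on a complete metric space, free of semigroups and integrals.\<close>

locale exp_lipschitz_semiflow =
  fixes flow :: "real \<Rightarrow> 'a::complete_space \<Rightarrow> 'a" and M \<omega> :: real
  assumes flow_0: "flow 0 x = x"
    and flow_add: "s \<ge> 0 \<Longrightarrow> t \<ge> 0 \<Longrightarrow> flow (s + t) x = flow t (flow s x)"
    and continuous_flow: "continuous_on {0..} (\<lambda>t. flow t x)"
    and dist_flow: "t \<ge> 0 \<Longrightarrow> dist (flow t x) (flow t y) \<le> M * exp (\<omega> * t) * dist x y"
begin

text \<open>
  An equivalent metric for which the flow is exponentially Lipschitz with constant 1 in place of
  \<open>M\<close>; it makes the errors of successive approximation steps add up without powers of \<open>M\<close>.
\<close>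

definition flow_dist :: "'a \<Rightarrow> 'a \<Rightarrow> real" where
  "flow_dist x y = (SUP t\<in>{0..}. exp (- \<omega> * t) * dist (flow t x) (flow t y))"

text \<open>Keeps the supremum in \<open>flow_dist\<close> finite, and is at the same time the upper
  half of the equivalence with \<open>dist\<close>.\<close>

lemma weighted_dist_le:
  assumes "t \<ge> 0"
  shows "exp (- \<omega> * t) * dist (flow t x) (flow t y) \<le> M * dist x y"
proof -
  have "exp (- \<omega> * t) * dist (flow t x) (flow t y) \<le> exp (- \<omega> * t) * (M * exp (\<omega> * t) * dist x y)"
    by (intro mult_left_mono dist_flow assms) auto
  then show ?thesis by (simp add: exp_minus field_simps)
qed

lemma flow_dist_upper:
  "t \<ge> 0 \<Longrightarrow> exp (- \<omega> * t) * dist (flow t x) (flow t y) \<le> flow_dist x y"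
  unfolding flow_dist_def
  by (intro cSUP_upper bdd_aboveI2[where M="M * dist x y"] weighted_dist_le) auto

lemma flow_dist_least:
  "(\<And>t. t \<ge> 0 \<Longrightarrow> exp (- \<omega> * t) * dist (flow t x) (flow t y) \<le> c) \<Longrightarrow> flow_dist x y \<le> c"
  unfolding flow_dist_def by (rule cSUP_least) auto

lemma dist_le_flow_dist: "dist x y \<le> flow_dist x y"
  using flow_dist_upper[of 0] by (simp add: flow_0)

lemma flow_dist_le: "flow_dist x y \<le> M * dist x y"
  by (intro flow_dist_least weighted_dist_le)

lemma flow_dist_triangle: "flow_dist x z \<le> flow_dist x y + flow_dist y z"
proof (rule flow_dist_least)
  fix t :: real assume t: "t \<ge> 0"
  have "exp (- \<omega> * t) * dist (flow t x) (flow t z)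
      \<le> exp (- \<omega> * t) * (dist (flow t x) (flow t y) + dist (flow t y) (flow t z))"
    by (intro mult_left_mono dist_triangle) auto
  also have "\<dots> \<le> flow_dist x y + flow_dist y z"
    unfolding distrib_left by (intro add_mono flow_dist_upper t)
  finally show "exp (- \<omega> * t) * dist (flow t x) (flow t z) \<le> flow_dist x y + flow_dist y z" .
qed

text \<open>Starting from \<open>flow s x\<close> and \<open>flow s y\<close> restricts the supremum
  to times from \<open>s\<close> on and rescales the weight by \<open>exp (\<omega> * s)\<close>;
  hence no factor \<open>M\<close> appears.\<close>

lemma flow_dist_flow:
  assumes "s \<ge> 0"
  shows "flow_dist (flow s x) (flow s y) \<le> exp (\<omega> * s) * flow_dist x y"
proof (rule flow_dist_least)
  fix t :: real assume t: "t \<ge> 0"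
  have "exp (- \<omega> * t) * dist (flow t (flow s x)) (flow t (flow s y))
      = exp (\<omega> * s) * (exp (- \<omega> * (s + t)) * dist (flow (s + t) x) (flow (s + t) y))"
    using assms t by (simp add: flow_add algebra_simps flip: exp_add mult.assoc)
  also have "\<dots> \<le> exp (\<omega> * s) * flow_dist x y"
    using assms t by (intro mult_left_mono flow_dist_upper) auto
  finally show "exp (- \<omega> * t) * dist (flow t (flow s x)) (flow t (flow s y))
      \<le> exp (\<omega> * s) * flow_dist x y" .
qed

text \<open>Moving the endpoints costs at most \<open>M * dist\<close> each, by the triangle
  inequality for \<open>flow_dist\<close>, and these costs vanish in the limit.\<close>

lemma flow_dist_le_limit:
  assumes "u \<longlonglongrightarrow> x" "v \<longlonglongrightarrow> y" "r \<longlonglongrightarrow> l"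
    and "\<forall>\<^sub>F n in sequentially. flow_dist (u n) (v n) \<le> r n"
  shows "flow_dist x y \<le> l"
proof (rule tendsto_lowerbound)
  have "(\<lambda>n. M * dist x (u n) + r n + M * dist (v n) y) \<longlonglongrightarrow> M * dist x x + l + M * dist y y"
    by (intro tendsto_intros assms)
  then show "(\<lambda>n. M * dist x (u n) + r n + M * dist (v n) y) \<longlonglongrightarrow> l"
    by simp
  show "\<forall>\<^sub>F n in sequentially. flow_dist x y \<le> M * dist x (u n) + r n + M * dist (v n) y"
    using assms(4)
  proof eventually_elim
    case (elim n)
    then show ?case
      using flow_dist_triangle[of x y "u n"] flow_dist_triangle[of "u n" y "v n"]
        flow_dist_le[of x "u n"] flow_dist_le[of "v n" y] by linarith
  qed
qed simp

text \<open>
  \<open>(t, y)\<close> precedes \<open>(t', y')\<close> if a trajectory that is in \<open>y\<close> at time \<open>t\<close> is, at time \<open>t'\<close>,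
  as close to \<open>y'\<close> as \<open>c\<close>-approximate solutions are required to be.
\<close>

definition precedes :: "real \<Rightarrow> real \<times> 'a \<Rightarrow> real \<times> 'a \<Rightarrow> bool" where
  "precedes c p q \<longleftrightarrow>
     fst p \<le> fst q \<and> flow_dist (flow (fst q - fst p) (snd p)) (snd q) \<le> c * phi \<omega> (fst q - fst p)"

lemma precedes_refl: "precedes c p p"
  using flow_dist_le[of "snd p" "snd p"] by (simp add: precedes_def flow_0)

text \<open>The first error is carried along by \<open>flow_dist_flow\<close>, and
  \<open>phi_add\<close> shows that the two errors sum exactly to the permitted one. With
  \<open>dist\<close> in place of \<open>flow_dist\<close>, each composition could cost a factor
  \<open>M\<close>.\<close>

lemma precedes_trans:
  assumes "precedes c p q" "precedes c q r"
  shows "precedes c p r"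
proof -
  obtain s x t y v z where pqr: "p = (s, x)" "q = (t, y)" "r = (v, z)"
    by (metis surj_pair)
  with assms have le: "s \<le> t" "t \<le> v"
    and xy: "flow_dist (flow (t - s) x) y \<le> c * phi \<omega> (t - s)"
    and yz: "flow_dist (flow (v - t) y) z \<le> c * phi \<omega> (v - t)"
    by (auto simp: precedes_def)
  have *: "v - s = (t - s) + (v - t)" by simp
  have "flow_dist (flow (v - s) x) z
      \<le> flow_dist (flow (v - t) (flow (t - s) x)) (flow (v - t) y) + flow_dist (flow (v - t) y) z"
    using le flow_dist_triangle unfolding * by (subst flow_add) auto
  also have "\<dots> \<le> exp (\<omega> * (v - t)) * (c * phi \<omega> (t - s)) + c * phi \<omega> (v - t)"
    using le xy by (intro add_mono yz order_trans[OF flow_dist_flow] mult_left_mono) auto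
  also have "\<dots> = c * phi \<omega> (v - s)"
    using le unfolding * by (subst phi_add) (auto simp: algebra_simps)
  finally show ?thesis
    using le by (simp add: precedes_def pqr)
qed

lemma precedes_chain:
  assumes "\<And>n. precedes c (f n) (f (Suc n))" "m \<le> n"
  shows "precedes c (f m) (f n)"
  using assms(2) by (induction rule: dec_induct) (auto intro: precedes_refl precedes_trans assms(1))

text \<open>The times increase to a limit \<open>l\<close>; once \<open>t n\<close> is close to
  \<open>l\<close>, little error is still permitted, so the later points gather near a single
  trajectory point. Completeness then supplies the limit.\<close>

lemma precedes_chain_limit:
  assumes step: "\<And>n. precedes c (f n) (f (Suc n))" and bounded: "\<And>n. fst (f n) \<le> T"
  obtains q where "f \<longlonglongrightarrow> q" "\<And>n. precedes c (f n) q"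
proof -
  note chain = precedes_chain[of c f, OF step]
  define t y where "t n = fst (f n)" and "y n = snd (f n)" for n
  have mono: "t m \<le> t n" if "m \<le> n" for m n
    using chain[OF that] by (simp add: precedes_def t_def)
  have d: "flow_dist (flow (t n - t m) (y m)) (y n) \<le> c * phi \<omega> (t n - t m)" if "m \<le> n" for m n
    using chain[OF that] by (simp add: precedes_def t_def y_def)
  have "incseq t" using mono by (auto simp: incseq_def)
  then obtain l where l: "t \<longlonglongrightarrow> l" "\<And>n. t n \<le> l"
    using incseq_convergent[of t T] bounded by (auto simp: t_def)
  have ev: "\<forall>\<^sub>F n in sequentially. t n - t m \<in> {0..}" for m
    using eventually_ge_at_top[of m] by eventually_elim (simp add: mono)
  have lim_diff: "(\<lambda>n. t n - t m) \<longlonglongrightarrow> l - t m" for m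
    by (intro tendsto_intros l)
  have flow_lim: "(\<lambda>n. flow (t n - t m) (y m)) \<longlonglongrightarrow> flow (l - t m) (y m)" for m
    using continuous_on_tendsto_compose[OF continuous_flow lim_diff _ ev] l(2) by auto
  have phi_lim: "(\<lambda>n. c * phi \<omega> (t n - t m)) \<longlonglongrightarrow> c * phi \<omega> (l - t m)" for m
    using continuous_on_tendsto_compose[OF continuous_on_phi lim_diff _ ev] l(2)
    by (auto intro!: tendsto_intros)
  have "Cauchy y"
  proof (rule metric_CauchyI)
    fix e :: real assume e: "e > 0"
    have "((\<lambda>n. c * phi \<omega> (l - t n)) \<longlonglongrightarrow> c * phi \<omega> (l - l))"
      by (intro tendsto_intros continuous_on_tendsto_compose[OF continuous_on_phi] l) (auto simp: l)
    then have "\<forall>\<^sub>F n in sequentially. c * phi \<omega> (l - t n) < e / 4"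
      using e by (intro order_tendstoD) auto
    \<comment> \<open>This \<open>n\<close> is fixed: all later \<open>y m\<close> are compared with
      \<open>flow (l - t n) (y n)\<close>, losing e/4 through the permitted error and e/4 through
      continuity of the trajectory.\<close>
    then obtain n where n: "c * phi \<omega> (l - t n) < e / 4"
      by (auto simp: eventually_sequentially)
    have "\<forall>\<^sub>F m in sequentially. c * phi \<omega> (t m - t n) < e / 4"
      using phi_lim n by (rule order_tendstoD)
    moreover have "\<forall>\<^sub>F m in sequentially. dist (flow (t m - t n) (y n)) (flow (l - t n) (y n)) < e / 4"
      using flow_lim e by (intro tendstoD) auto
    ultimately have "\<forall>\<^sub>F m in sequentially. dist (y m) (flow (l - t n) (y n)) < e / 2"
      using eventually_ge_at_top[of n]
    proof eventually_elim
      case (elim m)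
      have "dist (flow (t m - t n) (y n)) (y m) < e / 4"
        using elim d[of n m] dist_le_flow_dist[of "flow (t m - t n) (y n)" "y m"] by simp
      then show ?case
        using elim dist_triangle3[of "y m" "flow (l - t n) (y n)" "flow (t m - t n) (y n)"] e
        by linarith
    qed
    then obtain N where "\<And>m. m \<ge> N \<Longrightarrow> dist (y m) (flow (l - t n) (y n)) < e / 2"
      by (auto simp: eventually_sequentially)
    then show "\<exists>N. \<forall>m\<ge>N. \<forall>k\<ge>N. dist (y m) (y k) < e"
      by (blast intro: dist_triangle_half_l)
  qed
  then obtain z where z: "y \<longlonglongrightarrow> z"
    using Cauchy_convergent convergent_def by blast
  show ?thesis
  proof
    have "(\<lambda>n. (t n, y n)) \<longlonglongrightarrow> (l, z)"
      by (intro tendsto_Pair l z)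
    then show "f \<longlonglongrightarrow> (l, z)"
      by (simp add: t_def y_def)
    show "precedes c (f n) (l, z)" for n
      using flow_dist_le_limit[OF flow_lim z phi_lim eventually_sequentiallyI[of n, OF d]] l(2)[of n]
      by (simp add: precedes_def t_def y_def)
  qed
qed

text \<open>
  The Brezis--Browder argument: a chain which in each step advances by at least half of the time
  that is still reachable ends at a point without later successors.
\<close>

lemma reach_time:
  assumes K: "closed K" "y\<^sub>0 \<in> K" and T: "T \<ge> 0"
    and step: "\<And>y \<tau>. y \<in> K \<Longrightarrow> \<tau> > 0 \<Longrightarrow>
      \<exists>h y'. 0 < h \<and> h \<le> \<tau> \<and> y' \<in> K \<and> flow_dist (flow h y) y' \<le> c * phi \<omega> h"
  shows "\<exists>y\<in>K. flow_dist (flow T y\<^sub>0) y \<le> c * phi \<omega> T"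
proof -
  define Z where "Z = {0..T} \<times> K"
  have advance: "\<exists>q\<in>Z. precedes c p q \<and> (\<forall>r\<in>Z. precedes c p r \<longrightarrow> (fst p + fst r) / 2 \<le> fst q)"
    if "p \<in> Z" for p
  proof -
    define R where "R = {r \<in> Z. precedes c p r}"
    have p: "p \<in> R" using that by (simp add: R_def precedes_refl)
    have bdd: "bdd_above (fst ` R)"
      by (rule bdd_aboveI2[of _ _ T]) (auto simp: R_def Z_def)
    show ?thesis
    \<comment> \<open>If a later time is reachable, the midpoint lies strictly below the supremum
      and is exceeded by some member of \<open>R\<close>; otherwise \<open>p\<close> itself
      qualifies.\<close>
    proof (cases "fst p < Sup (fst ` R)")
      case True
      then have "(fst p + Sup (fst ` R)) / 2 < Sup (fst ` R)" by simp
      then obtain q where "q \<in> R" "(fst p + Sup (fst ` R)) / 2 < fst q"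
        using p bdd by (subst (asm) less_cSup_iff) auto
      moreover have "fst r \<le> Sup (fst ` R)" if "r \<in> R" for r
        using that bdd by (rule cSUP_upper)
      ultimately show ?thesis
        by (intro bexI[of _ q]) (fastforce simp: R_def)+
    next
      case False
      have "fst r \<le> fst p" if "r \<in> R" for r
        using cSUP_upper[OF that bdd] False by simp
      then show ?thesis
        using that by (intro bexI[of _ p]) (auto simp: R_def precedes_refl)
    qed
  qed
  define next_to where "next_to p q \<longleftrightarrow>
    precedes c p q \<and> (\<forall>r\<in>Z. precedes c p r \<longrightarrow> (fst p + fst r) / 2 \<le> fst q)" for p q
  have "\<exists>f. \<forall>n. (f n \<in> Z \<and> precedes c (0, y\<^sub>0) (f n)) \<and> next_to (f n) (f (Suc n))"
  proof (rule dependent_nat_choice)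
    show "\<exists>p. p \<in> Z \<and> precedes c (0, y\<^sub>0) p"
      using K T precedes_refl[of c "(0, y\<^sub>0)"] by (intro exI[of _ "(0, y\<^sub>0)"]) (simp add: Z_def)
    show "\<exists>q. (q \<in> Z \<and> precedes c (0, y\<^sub>0) q) \<and> next_to p q"
      if "p \<in> Z \<and> precedes c (0, y\<^sub>0) p" for p
      using advance[of p] that precedes_trans[of c "(0, y\<^sub>0)" p] unfolding next_to_def by blast
  qed
  then obtain f where f: "\<And>n. f n \<in> Z" "\<And>n. precedes c (0, y\<^sub>0) (f n)"
    and f_Suc: "\<And>n. precedes c (f n) (f (Suc n))"
      "\<And>n r. r \<in> Z \<Longrightarrow> precedes c (f n) r \<Longrightarrow> (fst (f n) + fst r) / 2 \<le> fst (f (Suc n))"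
    unfolding next_to_def by blast
  have "fst (f n) \<le> T" for n
    using f(1)[of n] by (auto simp: Z_def)
  from precedes_chain_limit[of c f T, OF f_Suc(1) this] obtain q
    where q: "f \<longlonglongrightarrow> q" "\<And>n. precedes c (f n) q" by metis
  have "closed Z" unfolding Z_def by (intro closed_Times K) auto
  then have qZ: "q \<in> Z" using q(1) f(1) closed_sequentially by blast
  \<comment> \<open>A successor of \<open>q\<close> later by \<open>h\<close> would succeed every
    \<open>f n\<close> too, so each step would advance at least halfway towards
    \<open>fst q + h\<close>; in the limit \<open>fst q\<close> would exceed itself by
    \<open>h / 2\<close>.\<close>
  have "fst q = T"
  proof (rule ccontr)
    assume "fst q \<noteq> T"
    then have "fst q < T" "snd q \<in> K" using qZ by (auto simp: Z_def)
    then obtain h y' where h: "0 < h" "h \<le> T - fst q" "y' \<in> K"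
      and "flow_dist (flow h (snd q)) y' \<le> c * phi \<omega> h"
      using step[of "snd q" "T - fst q"] by auto
    then have "precedes c q (fst q + h, y')" "(fst q + h, y') \<in> Z"
      using qZ by (auto simp: precedes_def Z_def)
    then have "(fst (f n) + (fst q + h)) / 2 \<le> fst (f (Suc n))" for n
      using f_Suc(2)[of "(fst q + h, y')" n] precedes_trans[OF q(2)[of n]] by simp
    moreover have "(\<lambda>n. (fst (f n) + (fst q + h)) / 2) \<longlonglongrightarrow> (fst q + (fst q + h)) / 2"
      by (intro tendsto_intros q) auto
    moreover have "(\<lambda>n. fst (f (Suc n))) \<longlonglongrightarrow> fst q"
      by (intro tendsto_intros LIMSEQ_Suc q)
    ultimately have "(fst q + (fst q + h)) / 2 \<le> fst q"
      by (intro LIMSEQ_le) auto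
    then show False using h by simp
  qed
  moreover have "precedes c (0, y\<^sub>0) q"
    using f(2) q(2) precedes_trans by blast
  ultimately show ?thesis
    using qZ by (auto simp: precedes_def Z_def)
qed

text \<open>For a start in \<open>K\<close>, \<open>reach_time\<close> applies. A general
  \<open>x\<close> is compared with the trajectory of an arbitrary \<open>y\<close> in
  \<open>K\<close>; the limit in \<open>c\<close> and the infimum over \<open>y\<close> are taken
  only at the end, so no nearest point is required.\<close>

theorem infdist_flow_le:
  assumes K: "closed K" "K \<noteq> {}" and M: "M > 0" and t: "t \<ge> 0"
    and tangent: "\<And>y c. y \<in> K \<Longrightarrow> c > \<epsilon> \<Longrightarrow> \<exists>\<^sub>F h in at_right 0. infdist (flow h y) K < c * h"
  shows "infdist (flow t x) K \<le> M * (exp (\<omega> * t) * infdist x K + phi \<omega> t * \<epsilon>)"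
proof -
  have in_K: "infdist (flow t x) K \<le> M * (exp (\<omega> * t) * dist x y + phi \<omega> t * c)"
    if y: "y \<in> K" and c: "c > \<epsilon>" for y c
  proof -
    \<comment> \<open>The factor \<open>M\<close> enters here once, when the tangency bound in
      \<open>dist\<close> is converted to \<open>flow_dist\<close>; returning to \<open>dist\<close>
      afterwards is free.\<close>
    have "\<exists>z\<in>K. flow_dist (flow t y) z \<le> (M * c) * phi \<omega> t"
    proof (rule reach_time[OF K(1) y t])
      fix w and \<tau> :: real assume w: "w \<in> K" and "\<tau> > 0"
      \<comment> \<open>A distance is never negative, so tangency itself forces this. It makes
        \<open>c\<close> positive, as the quotient \<open>c' / c\<close> below requires.\<close>
      have "\<epsilon> \<ge> 0"
      proof (rule ccontr)
        assume "\<not> \<epsilon> \<ge> 0"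
        then have "\<exists>\<^sub>F h in at_right 0. infdist (flow h w) K < 0 * h"
          by (intro tangent w) auto
        then show False by (simp add: infdist_nonneg not_less frequently_def)
      qed
      \<comment> \<open>The gap between \<open>c'\<close> and \<open>c\<close> absorbs the
        difference between \<open>h\<close> and \<open>phi \<omega> h\<close>: their ratio tends to
        1, so \<open>c' * h \<le> c * phi \<omega> h\<close> for small \<open>h\<close>.\<close>
      define c' where "c' = (\<epsilon> + c) / 2"
      have c': "c' > \<epsilon>" "c' < c" using c by (auto simp: c'_def)
      have "c' / c < 1" using c' \<open>\<epsilon> \<ge> 0\<close> by simp
      then have "\<forall>\<^sub>F h in at_right 0. c' / c < phi \<omega> h / h"
        using phi_over_tendsto_1 order_tendstoD(1) by blast
      moreover have "\<forall>\<^sub>F h in at_right 0. 0 < h \<and> h \<le> \<tau>"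
        using \<open>\<tau> > 0\<close> by (auto simp: eventually_at_right_field intro!: exI[of _ \<tau>])
      ultimately have "\<forall>\<^sub>F h in at_right 0. 0 < h \<and> h \<le> \<tau> \<and> c' * h \<le> c * phi \<omega> h"
        by eventually_elim (use c' \<open>\<epsilon> \<ge> 0\<close> in \<open>auto simp: field_simps\<close>)
      with tangent[OF w c'(1)]
      have "\<exists>\<^sub>F h in at_right 0. infdist (flow h w) K < c' * h \<and>
          (0 < h \<and> h \<le> \<tau> \<and> c' * h \<le> c * phi \<omega> h)"
        by (simp add: frequently_eventually_frequently)
      then obtain h where h: "0 < h" "h \<le> \<tau>" and "infdist (flow h w) K < c * phi \<omega> h"
        by (fastforce dest: frequently_ex)
      then obtain z where z: "z \<in> K" "dist (flow h w) z < c * phi \<omega> h"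
        using K(2) by (auto simp: infdist_notempty cINF_less_iff)
      have "flow_dist (flow h w) z \<le> M * dist (flow h w) z" by (rule flow_dist_le)
      also have "\<dots> \<le> M * (c * phi \<omega> h)" using z M by simp
      finally show "\<exists>h z. 0 < h \<and> h \<le> \<tau> \<and> z \<in> K \<and> flow_dist (flow h w) z \<le> M * c * phi \<omega> h"
        using h z by (auto simp: mult.assoc)
    qed
    then obtain z where z: "z \<in> K" "flow_dist (flow t y) z \<le> M * c * phi \<omega> t"
      by blast
    have "infdist (flow t x) K \<le> dist (flow t x) z"
      using z(1) by (rule infdist_le)
    also have "\<dots> \<le> dist (flow t x) (flow t y) + dist (flow t y) z"
      by (rule dist_triangle)
    also have "\<dots> \<le> M * exp (\<omega> * t) * dist x y + M * c * phi \<omega> t"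
      using z(2) by (intro add_mono dist_flow t order_trans[OF dist_le_flow_dist])
    finally show ?thesis by (simp add: algebra_simps)
  qed
  have "infdist (flow t x) K \<le> M * (exp (\<omega> * t) * dist x y + phi \<omega> t * \<epsilon>)" if "y \<in> K" for y
  proof (rule tendsto_lowerbound)
    show "((\<lambda>c. M * (exp (\<omega> * t) * dist x y + phi \<omega> t * c))
        \<longlongrightarrow> M * (exp (\<omega> * t) * dist x y + phi \<omega> t * \<epsilon>)) (at_right \<epsilon>)"
      by (intro tendsto_intros)
    show "\<forall>\<^sub>F c in at_right \<epsilon>.
        infdist (flow t x) K \<le> M * (exp (\<omega> * t) * dist x y + phi \<omega> t * c)"
      using in_K[OF that] by (auto simp: eventually_at_right_field intro!: exI[of _ "\<epsilon> + 1"])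
  qed simp
  \<comment> \<open>Solved for \<open>dist x y\<close>, so that the left side is a lower bound
    independent of \<open>y\<close> and the infimum over \<open>K\<close> can be taken.\<close>
  then have "(infdist (flow t x) K / M - phi \<omega> t * \<epsilon>) / exp (\<omega> * t) \<le> dist x y" if "y \<in> K" for y
    using that M by (simp add: field_simps)
  then have "(infdist (flow t x) K / M - phi \<omega> t * \<epsilon>) / exp (\<omega> * t) \<le> infdist x K"
    using K(2) by (simp add: infdist_notempty cINF_greatest)
  then show ?thesis using M by (simp add: field_simps)
qed

end

section \<open>Mild solutions under Lipschitz perturbations\<close>

text \<open>\<open>f\<close> itself is merely continuous, but its majorant \<open>F\<close> is
  differentiable inside the interval, and \<open>exp (- k * t) * F t\<close> is nonincreasing
  there.\<close>

lemma gronwall: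
  fixes f :: "real \<Rightarrow> real"
  assumes "T \<ge> 0" "k \<ge> 0" and f: "continuous_on {0..T} f"
    and le: "\<And>t. t \<in> {0..T} \<Longrightarrow> f t \<le> c + k * integral {0..t} f"
  shows "f T \<le> c * exp (k * T)"
proof -
  define F where "F t = c + k * integral {0..t} f" for t
  have "exp (- k * T) * F T \<le> exp (- k * 0) * F 0"
  proof (rule DERIV_nonpos_imp_decreasing_open[OF \<open>T \<ge> 0\<close>])
    fix t assume t: "0 < t" "t < T"
    have "((\<lambda>t. integral {0..t} f) has_real_derivative f t) (at t)"
      using integral_has_real_derivative[OF f, of t] t by (simp add: at_within_Icc_at)
    then have "((\<lambda>t. exp (- k * t) * F t) has_real_derivative
        exp (- k * t) * (k * (f t - F t))) (at t)"
      unfolding F_def by (auto intro!: derivative_eq_intros simp: algebra_simps)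
    moreover have "exp (- k * t) * (k * (f t - F t)) \<le> 0"
      using le[of t] t \<open>k \<ge> 0\<close> by (simp add: F_def mult_nonneg_nonpos)
    ultimately show "\<exists>y. ((\<lambda>t. exp (- k * t) * F t) has_real_derivative y) (at t) \<and> y \<le> 0"
      by blast
  next
    show "continuous_on {0..T} (\<lambda>t. exp (- k * t) * F t)"
      unfolding F_def
      by (intro continuous_intros indefinite_integral_continuous_1 integrable_continuous_interval f)
  qed
  then have "F T \<le> c * exp (k * T)"
    by (simp add: F_def exp_minus field_simps)
  with le[of T] \<open>T \<ge> 0\<close> show ?thesis
    by (simp add: F_def)
qed

section \<open>Strong and joint continuity of the semigroup\<close>

locale bounded_C0_semigroup =
  fixes S :: "real \<Rightarrow> 'a::banach \<Rightarrow>\<^sub>L 'a" and M \<beta> :: real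
  assumes C0: "C0_semigroup S"
    and growth: "t \<ge> 0 \<Longrightarrow> norm (S t) \<le> M * exp (\<beta> * t)"
begin

lemma S_0: "S 0 x = x"
  using C0 by (simp add: C0_semigroup_def)

lemma S_add: "s \<ge> 0 \<Longrightarrow> t \<ge> 0 \<Longrightarrow> S (s + t) x = S s (S t x)"
  using C0 by (simp add: C0_semigroup_def)

lemma norm_S_le: "t \<ge> 0 \<Longrightarrow> norm (S t x) \<le> M * exp (\<beta> * t) * norm x"
  by (meson growth mult_right_mono norm_blinfun norm_ge_zero order_trans)

lemma M_nonneg: "M \<ge> 0"
  using order_trans[OF norm_ge_zero growth[of 0]] by simp

text \<open>Right continuity at 0 suffices: increments to either side of \<open>t\<close> have the
  form \<open>S a (S h x - x)\<close> with \<open>a\<close> the smaller time, and \<open>S a\<close>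
  is bounded uniformly near \<open>t\<close>.\<close>

lemma continuous_on_S: "continuous_on {0..} (\<lambda>t. S t x)"
  unfolding continuous_on_iff
proof (intro ballI allI impI)
  fix t e :: real assume t: "t \<in> {0..}" and e: "e > 0"
  \<comment> \<open>Dominates \<open>M * exp (\<beta> * a)\<close> for all \<open>a\<close> in
    \<open>{0..t + 1}\<close>, whatever the sign of \<beta>; \<open>M + 1\<close> ensures
    positivity.\<close>
  define B where "B = (M + 1) * exp (\<bar>\<beta>\<bar> * (t + 1))"
  have B: "B > 0" using M_nonneg by (simp add: B_def)
  have "((\<lambda>t. S t x) \<longlongrightarrow> x) (at_right 0)"
    using C0 by (simp add: C0_semigroup_def)
  then have "\<forall>\<^sub>F h in at_right 0. dist (S h x) x < e / B"
    using e B by (intro tendstoD) auto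
  then obtain d where d: "d > 0" "\<And>h. 0 < h \<Longrightarrow> h < d \<Longrightarrow> dist (S h x) x < e / B"
    by (auto simp: eventually_at_right_field)
  have "dist (S s x) (S t x) < e" if s: "s \<in> {0..}" "dist s t < min d 1" for s
  proof (cases "s = t")
    case False
    define a h where "a = min s t" and "h = \<bar>s - t\<bar>"
    have ah: "0 \<le> a" "a \<le> t + 1" "0 < h" "h < d"
      using s t False by (auto simp: a_def h_def dist_real_def)
    have "\<beta> * a \<le> \<bar>\<beta>\<bar> * (t + 1)"
      using ah by (intro mult_mono) auto
    then have "M * exp (\<beta> * a) \<le> B"
      unfolding B_def using M_nonneg by (intro mult_mono) auto
    have "dist (S s x) (S t x) = norm (S (a + h) x - S a x)"
      by (cases "s \<le> t") (auto simp: a_def h_def dist_norm norm_minus_commute)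
    also have "\<dots> = norm (S a (S h x - x))"
      using ah by (simp add: S_add blinfun.diff_right)
    also have "\<dots> \<le> M * exp (\<beta> * a) * norm (S h x - x)"
      using ah by (intro norm_S_le)
    also have "\<dots> \<le> B * norm (S h x - x)"
      using \<open>M * exp (\<beta> * a) \<le> B\<close> by (intro mult_right_mono) auto
    also have "\<dots> < e"
      using d(2)[of h] ah B by (simp add: dist_norm field_simps)
    finally show ?thesis .
  qed (use e in simp)
  then show "\<exists>d>0. \<forall>s\<in>{0..}. dist s t < d \<longrightarrow> dist (S s x) (S t x) < e"
    using d(1) by (intro exI[of _ "min d 1"]) auto
qed

text \<open>The argument is split into \<open>g r - x\<close>, controlled by the growth bound, and
  the fixed \<open>x\<close>, controlled by strong continuity.\<close>

lemma tendsto_S: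
  assumes f: "(f \<longlongrightarrow> t) F" "\<forall>\<^sub>F r in F. f r \<ge> 0" "t \<ge> 0" and g: "(g \<longlongrightarrow> x) F"
  shows "((\<lambda>r. S (f r) (g r)) \<longlongrightarrow> S t x) F"
proof -
  have "((\<lambda>r. S (f r) (g r - x)) \<longlongrightarrow> 0) F"
  proof (rule Lim_null_comparison)
    show "\<forall>\<^sub>F r in F. norm (S (f r) (g r - x)) \<le> M * exp (\<beta> * f r) * norm (g r - x)"
      using f(2) by eventually_elim (rule norm_S_le)
    have "((\<lambda>r. M * exp (\<beta> * f r) * norm (g r - x)) \<longlongrightarrow> M * exp (\<beta> * t) * norm (x - x)) F"
      by (intro tendsto_intros f g)
    then show "((\<lambda>r. M * exp (\<beta> * f r) * norm (g r - x)) \<longlongrightarrow> 0) F"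
      by simp
  qed
  moreover have "((\<lambda>r. S (f r) x) \<longlongrightarrow> S t x) F"
    using continuous_on_tendsto_compose[OF continuous_on_S f(1)] f by simp
  ultimately have "((\<lambda>r. S (f r) (g r - x) + S (f r) x) \<longlongrightarrow> 0 + S t x) F"
    by (rule tendsto_add)
  then show ?thesis
    by (simp add: blinfun.diff_right)
qed

lemma continuous_on_S_compose:
  assumes "continuous_on T f" "continuous_on T g" "\<And>r. r \<in> T \<Longrightarrow> f r \<ge> 0"
  shows "continuous_on T (\<lambda>r. S (f r) (g r))"
  using assms unfolding continuous_on_def
  by (auto intro!: tendsto_S simp: eventually_at_filter)

end

section \<open>Mild solutions: stability, semiflow law, first-order expansion\<close>

locale lipschitz_perturbation = bounded_C0_semigroup S M \<beta>
  for S :: "real \<Rightarrow> 'a::banach \<Rightarrow>\<^sub>L 'a" and M \<beta> :: real +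
  fixes \<alpha> :: "'a \<Rightarrow> 'a" and L :: real
  assumes lipschitz: "L-lipschitz_on UNIV \<alpha>"
begin

lemma continuous_on_\<alpha>: "continuous_on T \<alpha>"
  using lipschitz lipschitz_on_continuous_on lipschitz_on_subset by blast

lemma continuous_on_convolution:
  assumes "continuous_on {0..} u" "\<And>s. s \<in> T \<Longrightarrow> 0 \<le> s \<and> s \<le> t"
  shows "continuous_on T (\<lambda>s. S (t - s) (\<alpha> (u s)))"
  using assms
  by (intro continuous_on_S_compose continuous_intros continuous_on_compose2[OF continuous_on_\<alpha>]
      continuous_on_subset[OF assms(1)]) auto

text \<open>The weight \<open>exp (- \<beta> * s)\<close> cancels the growth of the convolution
  kernel, leaving a Gronwall inequality with constant \<open>M * L\<close>. The case
  \<open>x = y\<close> is uniqueness.\<close>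

lemma mild_solution_dist_le:
  assumes u: "mild_solution S \<alpha> x u" and v: "mild_solution S \<alpha> y v" and t: "t \<ge> 0"
  shows "dist (u t) (v t) \<le> M * exp ((\<beta> + M * L) * t) * dist x y"
proof -
  have cont: "continuous_on {0..} u" "continuous_on {0..} v"
    using u v by (auto simp: mild_solution_def)
  define f where "f s = exp (- \<beta> * s) * norm (u s - v s)" for s
  have f_cont: "continuous_on {0..s} f" for s
    unfolding f_def by (intro continuous_intros continuous_on_subset[OF cont(1)]
        continuous_on_subset[OF cont(2)]) auto
  have "L \<ge> 0" using lipschitz lipschitz_on_nonneg by blast
  have "f t \<le> (M * norm (x - y)) * exp ((M * L) * t)"
  proof (rule gronwall[OF t _ f_cont])
    show "M * L \<ge> 0" using M_nonneg \<open>L \<ge> 0\<close> by simp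
    fix r assume "r \<in> {0..t}"
    then have r: "r \<ge> 0" by simp
    define Iu Iv where "Iu s = S (r - s) (\<alpha> (u s))" and "Iv s = S (r - s) (\<alpha> (v s))" for s
    have int: "Iu integrable_on {0..r}" "Iv integrable_on {0..r}"
      unfolding Iu_def Iv_def
      by (intro integrable_continuous_interval continuous_on_convolution cont; simp)+
    have "u r - v r = S r (x - y) + (integral {0..r} Iu - integral {0..r} Iv)"
      using u v r unfolding mild_solution_def Iu_def Iv_def by (simp add: blinfun.diff_right)
    also have "integral {0..r} Iu - integral {0..r} Iv = integral {0..r} (\<lambda>s. Iu s - Iv s)"
      by (rule integral_diff[symmetric, OF int])
    finally have "norm (u r - v r)
        \<le> norm (S r (x - y)) + norm (integral {0..r} (\<lambda>s. Iu s - Iv s))"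
      by (metis norm_triangle_ineq)
    also have "norm (S r (x - y)) \<le> M * exp (\<beta> * r) * norm (x - y)"
      by (rule norm_S_le[OF r])
    also have "norm (integral {0..r} (\<lambda>s. Iu s - Iv s))
        \<le> integral {0..r} (\<lambda>s. exp (\<beta> * r) * (M * L) * f s)"
    proof (rule integral_norm_bound_integral)
      show "(\<lambda>s. Iu s - Iv s) integrable_on {0..r}"
        by (intro integrable_diff int)
      show "(\<lambda>s. exp (\<beta> * r) * (M * L) * f s) integrable_on {0..r}"
        by (intro integrable_continuous_interval continuous_intros f_cont)
      fix s assume s: "s \<in> {0..r}"
      have "norm (Iu s - Iv s) = norm (S (r - s) (\<alpha> (u s) - \<alpha> (v s)))"
        by (simp add: Iu_def Iv_def blinfun.diff_right)
      also have "\<dots> \<le> M * exp (\<beta> * (r - s)) * norm (\<alpha> (u s) - \<alpha> (v s))"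
        using s by (intro norm_S_le) simp
      also have "\<dots> \<le> M * exp (\<beta> * (r - s)) * (L * norm (u s - v s))"
        using lipschitz_onD[OF lipschitz] M_nonneg by (intro mult_left_mono) (auto simp: dist_norm)
      also have "\<dots> = exp (\<beta> * r) * (M * L) * f s"
        by (simp add: f_def right_diff_distrib exp_diff exp_minus field_simps)
      finally show "norm (Iu s - Iv s) \<le> exp (\<beta> * r) * (M * L) * f s" .
    qed
    finally have "norm (u r - v r)
        \<le> exp (\<beta> * r) * (M * norm (x - y) + (M * L) * integral {0..r} f)"
      by (simp add: algebra_simps)
    then show "f r \<le> M * norm (x - y) + M * L * integral {0..r} f"
      by (simp add: f_def exp_minus field_simps)
  qed
  then have "norm (u t - v t) \<le> exp (\<beta> * t) * (M * norm (x - y) * exp (M * L * t))"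
    by (simp add: f_def exp_minus field_simps)
  then show ?thesis
    by (simp add: dist_norm algebra_simps flip: exp_add)
qed

lemma mild_solution_unique:
  "mild_solution S \<alpha> x u \<Longrightarrow> mild_solution S \<alpha> x v \<Longrightarrow> t \<ge> 0 \<Longrightarrow> u t = v t"
  using mild_solution_dist_le[of x u x v t] by simp

text \<open>The convolution is split at \<open>s\<close>; from the part before \<open>s\<close> the
  operator \<open>S t\<close> is pulled out by the semigroup law and linearity. Together with
  uniqueness this yields the semiflow law.\<close>

lemma mild_solution_shift:
  assumes u: "mild_solution S \<alpha> x u" and s: "s \<ge> 0"
  shows "mild_solution S \<alpha> (u s) (\<lambda>t. u (s + t))"
  unfolding mild_solution_def
proof (intro conjI allI impI)
  have cont: "continuous_on {0..} u"
    using u by (simp add: mild_solution_def)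
  show "continuous_on {0..} (\<lambda>t. u (s + t))"
    using s by (intro continuous_on_compose2[OF cont] continuous_intros) auto
  fix t :: real assume t: "t \<ge> 0"
  define I where "I r = S (s + t - r) (\<alpha> (u r))" for r
  have "I integrable_on {0..s + t}"
    unfolding I_def by (intro integrable_continuous_interval continuous_on_convolution cont) auto
  then have "integral {0..s + t} I = integral {0..s} I + integral {s..s + t} I"
    using s t
      Henstock_Kurzweil_Integration.integral_combine[where a=0 and c=s and b="s + t" and f=I] by simp
  also have "integral {s..s + t} I = integral {0..t} (\<lambda>r. I (r + s))"
    using integral_shift_real_ivl[of s s "s + t" I] by simp
  also have "\<dots> = integral {0..t} (\<lambda>r. S (t - r) (\<alpha> (u (s + r))))"
    by (simp add: I_def add_ac)
  also have "integral {0..s} I = integral {0..s} (S t \<circ> (\<lambda>r. S (s - r) (\<alpha> (u r))))"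
  proof (rule integral_cong)
    fix r assume r: "r \<in> {0..s}"
    have "s + t - r = t + (s - r)" by simp
    then show "I r = (S t \<circ> (\<lambda>r. S (s - r) (\<alpha> (u r)))) r"
      using r t unfolding I_def comp_def by (simp only: S_add atLeastAtMost_iff diff_ge_0_iff_ge)
  qed
  also have "\<dots> = S t (integral {0..s} (\<lambda>r. S (s - r) (\<alpha> (u r))))"
    by (intro integral_linear blinfun.bounded_linear_right integrable_continuous_interval
        continuous_on_convolution cont) auto
  finally have "integral {0..s + t} I = S t (integral {0..s} (\<lambda>r. S (s - r) (\<alpha> (u r))))
      + integral {0..t} (\<lambda>r. S (t - r) (\<alpha> (u (s + r))))" .
  moreover have "u (s + t) = S (s + t) x + integral {0..s + t} I"
    and "u s = S s x + integral {0..s} (\<lambda>r. S (s - r) (\<alpha> (u r)))"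
    using u s t unfolding mild_solution_def I_def by simp_all
  moreover have "S (s + t) x = S t (S s x)"
    using S_add[OF t s] by (simp add: add.commute)
  ultimately show "u (s + t) = S t (u s) + integral {0..t} (\<lambda>r. S (t - r) (\<alpha> (u (s + r))))"
    by (simp add: blinfun.add_right)
qed

lemma mild_solution_0: "mild_solution S \<alpha> x u \<Longrightarrow> u 0 = x"
  by (simp add: mild_solution_def S_0)

text \<open>The error is the integral of \<open>S (t - s) (\<alpha> (u s)) - \<alpha> x\<close> over
  \<open>{0..t}\<close>, and its integrand is uniformly small because
  \<open>S r (\<alpha> (u s))\<close> is jointly continuous in \<open>(r, s)\<close> with value
  \<open>\<alpha> x\<close> at the origin.\<close>

lemma mild_solution_first_order:
  assumes u: "mild_solution S \<alpha> x u"
  shows "((\<lambda>t. dist (u t) (S t x + t *\<^sub>R \<alpha> x) / t) \<longlongrightarrow> 0) (at_right 0)"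
proof (rule tendstoI)
  fix e :: real assume e: "e > 0"
  have cont: "continuous_on {0..} u"
    using u by (simp add: mild_solution_def)
  have "continuous_on ({0..} \<times> {0..}) (\<lambda>p. S (fst p) (\<alpha> (u (snd p))))"
    by (intro continuous_on_S_compose continuous_intros continuous_on_compose2[OF continuous_on_\<alpha>]
        continuous_on_compose2[OF cont]) auto
  then obtain d where d: "d > 0"
    and close: "\<And>r s. r \<ge> 0 \<Longrightarrow> s \<ge> 0 \<Longrightarrow> dist (r, s) (0, 0) < d \<Longrightarrow>
      dist (S r (\<alpha> (u s))) (S 0 (\<alpha> (u 0))) < e / 2"
    using e unfolding continuous_on_iff
    by (elim ballE[of _ _ "(0, 0)"] allE[of _ "e / 2"]) auto
  have "dist (u t) (S t x + t *\<^sub>R \<alpha> x) / t < e" if t: "0 < t" "t < d" for t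
  proof -
    define I where "I s = S (t - s) (\<alpha> (u s))" for s
    have I: "continuous_on {0..t} I"
      unfolding I_def by (intro continuous_on_convolution cont) auto
    have "u t = S t x + integral {0..t} I"
      using u t unfolding I_def by (simp add: mild_solution_def)
    then have "dist (u t) (S t x + t *\<^sub>R \<alpha> x) = norm (integral {0..t} I - integral {0..t} (\<lambda>_. \<alpha> x))"
      using t by (simp add: dist_norm)
    also have "\<dots> = norm (integral {0..t} (\<lambda>s. I s - \<alpha> x))"
      by (subst integral_diff) (auto intro: integrable_continuous_interval I)
    also have "\<dots> \<le> e / 2 * (t - 0)"
    proof (rule integral_bound)
      fix s assume s: "s \<in> {0..t}"
      have "dist (t - s, s) (0, 0) \<le> norm (t - s) + norm s"
        unfolding dist_norm by (metis diff_zero norm_Pair_le prod.collapse zero_prod_def)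
      then have "dist (t - s, s) (0, 0) < d"
        using s t by simp
      with close[of "t - s" s] s show "norm (I s - \<alpha> x) \<le> e / 2"
        by (simp add: I_def S_0 mild_solution_0[OF u] dist_norm)
    qed (use t in \<open>auto intro!: continuous_intros I\<close>)
    also have "\<dots> < e * t" using e t by simp
    finally show ?thesis using t by (simp add: field_simps)
  qed
  then show "\<forall>\<^sub>F t in at_right 0. dist (dist (u t) (S t x + t *\<^sub>R \<alpha> x) / t) 0 < e"
    using d by (auto simp: eventually_at_right_field intro!: exI[of _ d])
qed

end

section \<open>Lower limits and the three implications\<close>

lemma Liminf_le_imp_frequently_less:
  fixes f :: "'a \<Rightarrow> 'b::complete_linorder"
  assumes "Liminf F f \<le> l" "l < c"
  shows "\<exists>\<^sub>F x in F. f x < c"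
proof (rule ccontr)
  assume "\<not> (\<exists>\<^sub>F x in F. f x < c)"
  then have "\<forall>\<^sub>F x in F. c \<le> f x"
    by (simp add: not_frequently not_less)
  then have "c \<le> Liminf F f"
    by (rule Liminf_bounded)
  with assms show False by simp
qed

theorem theorem2p8:
  fixes S :: "real \<Rightarrow> 'a::banach \<Rightarrow>\<^sub>L 'a"
    and D :: "'a set" and A :: "'a \<Rightarrow> 'a"
    and \<alpha> :: "'a \<Rightarrow> 'a"
    and \<xi> :: "real \<Rightarrow> 'a \<Rightarrow> 'a"
    and K :: "'a set"
    and M \<beta> L \<epsilon> :: real
  assumes "C0_semigroup S"
    and "infinitesimal_generator D A S"
    and "M \<ge> 1"
    and "\<forall>t\<ge>0. norm (S t) \<le> M * exp (\<beta> * t)"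
    and "L \<ge> 0"
    and "L-lipschitz_on UNIV \<alpha>"
    and "closed K" and "K \<noteq> {}"
    and "\<forall>x. mild_solution S \<alpha> x (\<lambda>t. \<xi> t x)"
    and "\<epsilon> \<ge> 0"
  shows
    "((\<forall>x\<in>K. Liminf (at_right 0)
          (\<lambda>t. ereal (1 / t * infdist (blinfun_apply (S t) x + t *\<^sub>R \<alpha> x) K)) \<le> ereal \<epsilon>)
      \<longrightarrow>
      (\<forall>t\<ge>0. \<forall>x. infdist (\<xi> t x) K
          \<le> M * (exp ((\<beta> + M * L) * t) * infdist x K + phi (\<beta> + M * L) t * \<epsilon>)))
     \<and>
     ((\<forall>t\<ge>0. \<forall>x. infdist (\<xi> t x) K
          \<le> M * (exp ((\<beta> + M * L) * t) * infdist x K + phi (\<beta> + M * L) t * \<epsilon>))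
      \<longrightarrow>
      (\<exists>\<delta>>0. \<forall>t\<in>{0..\<delta>}. \<forall>x\<in>K. infdist (\<xi> t x) K \<le> M * phi (\<beta> + M * L) t * \<epsilon>))
     \<and>
     ((\<exists>\<delta>>0. \<forall>t\<in>{0..\<delta>}. \<forall>x\<in>K. infdist (\<xi> t x) K \<le> M * phi (\<beta> + M * L) t * \<epsilon>)
      \<longrightarrow>
      (\<forall>x\<in>K. Liminf (at_right 0)
          (\<lambda>t. ereal (1 / t * infdist (blinfun_apply (S t) x + t *\<^sub>R \<alpha> x) K)) \<le> ereal (M * \<epsilon>)))"
proof (intro conjI impI ballI allI)
  interpret lipschitz_perturbation S M \<beta> \<alpha> L
    using assms by unfold_locales auto
  have mild: "mild_solution S \<alpha> x (\<lambda>t. \<xi> t x)" for x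
    using assms by blast
  interpret exp_lipschitz_semiflow \<xi> M "\<beta> + M * L"
  proof
    show "\<xi> 0 x = x" for x
      by (rule mild_solution_0[OF mild])
    show "\<xi> (s + t) x = \<xi> t (\<xi> s x)" if "s \<ge> 0" "t \<ge> 0" for s t x
      using mild_solution_unique[OF mild_solution_shift[OF mild] mild] that .
    show "continuous_on {0..} (\<lambda>t. \<xi> t x)" for x
      using mild by (simp add: mild_solution_def)
    show "dist (\<xi> t x) (\<xi> t y) \<le> M * exp ((\<beta> + M * L) * t) * dist x y" if "t \<ge> 0" for t x y
      by (rule mild_solution_dist_le[OF mild mild that])
  qed
  let ?d = "\<lambda>x t. infdist (S t x + t *\<^sub>R \<alpha> x) K"
  let ?r = "\<lambda>x t. dist (\<xi> t x) (S t x + t *\<^sub>R \<alpha> x) / t"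
  have pos: "\<forall>\<^sub>F t :: real in at_right 0. t > 0"
    by (rule eventually_at_right_less)
  show "infdist (\<xi> t x) K
      \<le> M * (exp ((\<beta> + M * L) * t) * infdist x K + phi (\<beta> + M * L) t * \<epsilon>)"
    if i: "\<forall>x\<in>K. Liminf (at_right 0) (\<lambda>t. ereal (1 / t * ?d x t)) \<le> ereal \<epsilon>" and t: "t \<ge> 0"
    for t x
  proof (rule infdist_flow_le)
    fix y c assume y: "y \<in> K" and c: "c > \<epsilon>"
    \<comment> \<open>The lower limit yields \<open>c' * t\<close> for arbitrarily small
      \<open>t\<close> only; the remaining \<open>c - c'\<close> pays for the first-order error,
      which is small for all small \<open>t\<close>.\<close>
    define c' where "c' = (\<epsilon> + c) / 2"
    have c': "\<epsilon> < c'" "c' < c" using c by (auto simp: c'_def)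
    have "\<exists>\<^sub>F t in at_right 0. ereal (1 / t * ?d y t) < ereal c'"
      using i y c' by (intro Liminf_le_imp_frequently_less[where l="ereal \<epsilon>"]) auto
    moreover have "\<forall>\<^sub>F t in at_right 0. ?r y t < c - c' \<and> t > 0"
      using mild_solution_first_order[OF mild, of y] c'
      by (intro eventually_conj pos order_tendstoD(2)) auto
    ultimately have "\<exists>\<^sub>F t in at_right 0. (?r y t < c - c' \<and> t > 0) \<and> ereal (1 / t * ?d y t) < ereal c'"
      by (rule frequently_eventually_conj)
    then show "\<exists>\<^sub>F t in at_right 0. infdist (\<xi> t y) K < c * t"
    proof (rule frequently_elim1)
      fix t assume "(?r y t < c - c' \<and> t > 0) \<and> ereal (1 / t * ?d y t) < ereal c'"
      then have "dist (\<xi> t y) (S t y + t *\<^sub>R \<alpha> y) < (c - c') * t" "?d y t < c' * t"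
        by (auto simp: field_simps)
      with infdist_triangle[of "\<xi> t y" K "S t y + t *\<^sub>R \<alpha> y"]
      show "infdist (\<xi> t y) K < c * t"
        by (simp add: left_diff_distrib)
    qed
  qed (use assms t in auto)
  show "\<exists>\<delta>>0. \<forall>t\<in>{0..\<delta>}. \<forall>x\<in>K. infdist (\<xi> t x) K \<le> M * phi (\<beta> + M * L) t * \<epsilon>"
    if ii: "\<forall>t\<ge>0. \<forall>x. infdist (\<xi> t x) K
      \<le> M * (exp ((\<beta> + M * L) * t) * infdist x K + phi (\<beta> + M * L) t * \<epsilon>)"
  \<comment> \<open>Any positive bound on time would do: on \<open>K\<close> the term with
    \<open>infdist x K\<close> vanishes.\<close>
  proof (intro exI[of _ 1] conjI ballI)
    fix t x assume "t \<in> {0..1::real}" "x \<in> K"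
    then show "infdist (\<xi> t x) K \<le> M * phi (\<beta> + M * L) t * \<epsilon>"
      using ii[rule_format, of t x] by (simp add: mult.assoc)
  qed simp
  show "Liminf (at_right 0) (\<lambda>t. ereal (1 / t * ?d x t)) \<le> ereal (M * \<epsilon>)"
    if iii: "\<exists>\<delta>>0. \<forall>t\<in>{0..\<delta>}. \<forall>x\<in>K. infdist (\<xi> t x) K \<le> M * phi (\<beta> + M * L) t * \<epsilon>"
      and x: "x \<in> K" for x
  proof -
    \<comment> \<open>A majorant of the quotient near 0, by the triangle inequality through
      \<open>\<xi> t x\<close>; it has the genuine limit \<open>M * \<epsilon>\<close>, so
      monotonicity of \<open>Liminf\<close> finishes.\<close>
    let ?b = "\<lambda>t. M * \<epsilon> * (phi (\<beta> + M * L) t / t) + ?r x t"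
    obtain \<delta> where \<delta>: "\<delta> > 0"
      "\<And>t. 0 \<le> t \<Longrightarrow> t \<le> \<delta> \<Longrightarrow> infdist (\<xi> t x) K \<le> M * phi (\<beta> + M * L) t * \<epsilon>"
      using iii x by auto
    have "(?b \<longlongrightarrow> M * \<epsilon> * 1 + 0) (at_right 0)"
      by (intro tendsto_intros phi_over_tendsto_1 mild_solution_first_order mild)
    then have "((\<lambda>t. ereal (?b t)) \<longlongrightarrow> ereal (M * \<epsilon>)) (at_right 0)"
      by simp
    then have "Liminf (at_right 0) (\<lambda>t. ereal (?b t)) = ereal (M * \<epsilon>)"
      by (intro lim_imp_Liminf) auto
    moreover have "\<forall>\<^sub>F t in at_right 0. t < \<delta>"
      using \<delta>(1) by (auto simp: eventually_at_right_field)
    with pos have "\<forall>\<^sub>F t in at_right 0. ereal (1 / t * ?d x t) \<le> ereal (?b t)"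
    proof eventually_elim
      case (elim t)
      have "?d x t \<le> M * phi (\<beta> + M * L) t * \<epsilon> + dist (\<xi> t x) (S t x + t *\<^sub>R \<alpha> x)"
        using \<delta>(2)[of t] elim infdist_triangle[of "S t x + t *\<^sub>R \<alpha> x" K "\<xi> t x"]
        by (simp add: dist_commute)
      then show ?case
        using elim by (simp add: field_simps)
    qed
    then have "Liminf (at_right 0) (\<lambda>t. ereal (1 / t * ?d x t)) \<le> Liminf (at_right 0) (\<lambda>t. ereal (?b t))"
      by (rule Liminf_mono)
    ultimately show ?thesis by simp
  qed
qed

end
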